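(* Let $X$ be a topological space and let $\pi^X:\mathrm{Conf}(X,2)\to X$, $\pi^X(x_1,x_2)=x_1$, be the projection onto the first coordinate. If $\pi^X$ admits a continuous section, i.e. a continuous map $s:X\to\mathrm{Conf}(X,2)$ with $\pi^X\circ s=1_X$, then $\mathrm{cat}(\pi^X)=\mathrm{cat}(X)$.
   Context: $\mathrm{Conf}(X,2)=\{(x_1,x_2)\in X\times X: x_1\neq x_2\}$ with the subspace topology from $X\times X$ (ordered configuration space of two points). A continuous map is null-homotopic if it is (freely) homotopic to a constant map. The category $\mathrm{cat}(f)$ of a continuous map $f:Z\to Y$ is the least positive integer $n$ such that $Z$ is a union of open subsets $U_1,\dots,U_n$ with each restriction $f_{|U_i}:U_i\to Y$ null-homotopic, and $\infty$ if no such integer exists. The LS category $\mathrm{cat}(X)$ of a space $X$ is the least positive integer $k$ such that $X$ is a union of open subsets $U_1,\dots,U_k$ with each inclusion $U_j\hookrightarrow X$ null-homotopic, and $\infty$ if no such integer exists. *)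

theory Defs
  imports "HOL-Analysis.Analysis" "HOL-Library.Extended_Nat"
begin

definition Conf2 :: "'a topology \<Rightarrow> ('a \<times> 'a) topology" where
  "Conf2 X = subtopology (prod_topology X X)
     {(x1, x2). x1 \<in> topspace X \<and> x2 \<in> topspace X \<and> x1 \<noteq> x2}"

definition Conf2_proj :: "'a \<times> 'a \<Rightarrow> 'a" where
  "Conf2_proj = (\<lambda>(x1, x2). x1)"

text \<open>The homotopy is free (no condition on the intermediate maps). As in
  \<^const>\<open>contractible_space\<close>, the constant \<open>c\<close> lies in \<open>topspace Y\<close> automatically
  unless the domain is empty; the empty map counts as constant.\<close>
definition null_homotopic :: "'a topology \<Rightarrow> 'b topology \<Rightarrow> ('a \<Rightarrow> 'b) \<Rightarrow> bool" where
  "null_homotopic Z Y f \<longleftrightarrow> (\<exists>c. homotopic_with (\<lambda>h. True) Z Y f (\<lambda>z. c))"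

text \<open>In both definitions below, the infimum in \<^typ>\<open>enat\<close> of a nonempty set is its least
  element, and that of the empty set is \<open>\<infinity>\<close>.\<close>
definition cat_map :: "'a topology \<Rightarrow> 'b topology \<Rightarrow> ('a \<Rightarrow> 'b) \<Rightarrow> enat" where
  "cat_map Z Y f = Inf {enat n | n. 1 \<le> n \<and>
     (\<exists>U :: nat \<Rightarrow> 'a set.
        (\<forall>i\<in>{1..n}. openin Z (U i) \<and> null_homotopic (subtopology Z (U i)) Y f) \<and>
        topspace Z = (\<Union>i\<in>{1..n}. U i))}"

definition LS_cat :: "'a topology \<Rightarrow> enat" where
  "LS_cat X = Inf {enat k | k. 1 \<le> k \<and>
     (\<exists>U :: nat \<Rightarrow> 'a set.
        (\<forall>j\<in>{1..k}. openin X (U j) \<and> null_homotopic (subtopology X (U j)) X (\<lambda>x. x)) \<and>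
        topspace X = (\<Union>j\<in>{1..k}. U j))}"

end

theory Submission
  imports Defs
begin

(* Covers pull back along continuous maps, so the category of a composite f \<circ> g is at most that
   of f. Applied to \<pi> = id \<circ> \<pi> this gives cat(\<pi>) \<le> cat(X), and applied to id = \<pi> \<circ> s it
   gives cat(X) \<le> cat(\<pi>). *)

text \<open>Precomposing a homotopy from \<open>f\<close> to a constant with \<open>g\<close> gives
  one from \<open>f \<circ> g\<close> to the same constant. Agreement of \<open>h\<close> with
  \<open>f \<circ> g\<close> is asked only on \<open>topspace W\<close>, since a section is
  controlled only on the points of the space.\<close>

lemma null_homotopic_compose_right:
  assumes "null_homotopic Z Y f" and "continuous_map W Z g"
    and "\<And>w. w \<in> topspace W \<Longrightarrow> h w = f (g w)"
  shows "null_homotopic W Y h"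
proof -
  obtain c where "homotopic_with (\<lambda>_. True) Z Y f (\<lambda>_. c)"
    using assms(1) unfolding null_homotopic_def by blast
  then have "homotopic_with (\<lambda>_. True) W Y (f \<circ> g) ((\<lambda>_. c) \<circ> g)"
    using assms(2) by (rule homotopic_with_compose_continuous_map_right) simp
  then have "homotopic_with (\<lambda>_. True) W Y h (\<lambda>_. c)"
    by (rule homotopic_with_eq) (simp_all add: assms(3))
  then show ?thesis
    unfolding null_homotopic_def by blast
qed

lemma cat_map_compose_right_le:
  assumes g: "continuous_map W Z g"
    and h: "\<And>w. w \<in> topspace W \<Longrightarrow> h w = f (g w)"
  shows "cat_map W Y h \<le> cat_map Z Y f"
  unfolding cat_map_def
\<comment> \<open>Every \<open>n\<close> admissible for \<open>f\<close> is shown admissible for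
  \<open>h\<close>; if no \<open>n\<close> is admissible for \<open>f\<close>, the right-hand side
  is \<infinity>.\<close>
proof (rule Inf_superset_mono, safe)
  fix n :: nat and U :: "nat \<Rightarrow> _ set"
  assume n: "1 \<le> n" and cover: "topspace Z = (\<Union>i\<in>{1..n}. U i)"
    and U: "\<forall>i\<in>{1..n}. openin Z (U i) \<and> null_homotopic (subtopology Z (U i)) Y f"
  \<comment> \<open>Preimages of the cover: \<open>g\<close> restricts to a map from
    \<open>V i\<close> to \<open>U i\<close>, so the previous lemma applies piecewise. Some
    \<open>V i\<close> may be empty, which does no harm.\<close>
  define V where "V i = {w \<in> topspace W. g w \<in> U i}" for i
  have "openin W (V i) \<and> null_homotopic (subtopology W (V i)) Y h" if "i \<in> {1..n}" for i
  proof
    show "openin W (V i)"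
      unfolding V_def using g U that openin_continuous_map_preimage by blast
    have "null_homotopic (subtopology Z (U i)) Y f"
      using U that by blast
    moreover have "continuous_map (subtopology W (V i)) (subtopology Z (U i)) g"
      using g unfolding V_def
      by (auto simp: continuous_map_in_subtopology continuous_map_from_subtopology)
    ultimately show "null_homotopic (subtopology W (V i)) Y h"
      by (rule null_homotopic_compose_right) (simp add: h)
  qed
  moreover have "topspace W = (\<Union>i\<in>{1..n}. V i)"
    using continuous_map_image_subset_topspace[OF g] cover unfolding V_def by (auto simp: image_subset_iff)
  ultimately show "\<exists>m. enat n = enat m \<and> 1 \<le> m \<and>
     (\<exists>U. (\<forall>i\<in>{1..m}. openin W (U i) \<and> null_homotopic (subtopology W (U i)) Y h) \<and>
        topspace W = (\<Union>i\<in>{1..m}. U i))"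
    using n by (intro exI[of _ n] exI[of _ V] conjI ballI refl) simp_all
qed

lemma LS_cat_eq_cat_map: "LS_cat X = cat_map X X (\<lambda>x. x)"
  unfolding LS_cat_def cat_map_def ..

lemma continuous_map_Conf2_proj: "continuous_map (Conf2 X) X Conf2_proj"
proof -
  have "Conf2_proj = (fst :: 'a \<times> 'a \<Rightarrow> 'a)"
    by (auto simp: Conf2_proj_def)
  then show ?thesis
    unfolding Conf2_def by (simp add: continuous_map_fst continuous_map_from_subtopology)
qed

theorem mainTheorem7:
  fixes X :: "'a topology"
  assumes "\<exists>s. continuous_map X (Conf2 X) s \<and> (\<forall>x\<in>topspace X. Conf2_proj (s x) = x)"
  shows "cat_map (Conf2 X) X Conf2_proj = LS_cat X"
proof (rule antisym)
  show "cat_map (Conf2 X) X Conf2_proj \<le> LS_cat X"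
    unfolding LS_cat_eq_cat_map
    \<comment> \<open>Here \<open>f\<close> is the identity and \<open>g = h = Conf2_proj\<close>;
      no section is involved.\<close>
    by (rule cat_map_compose_right_le[OF continuous_map_Conf2_proj]) simp
  obtain s where "continuous_map X (Conf2 X) s" "\<forall>x\<in>topspace X. Conf2_proj (s x) = x"
    using assms by blast
  \<comment> \<open>Now \<open>f = Conf2_proj\<close>, \<open>g = s\<close> and \<open>h\<close> is
    the identity, so the section equation is exactly the required agreement.\<close>
  then show "LS_cat X \<le> cat_map (Conf2 X) X Conf2_proj"
    unfolding LS_cat_eq_cat_map by (intro cat_map_compose_right_le[where g = s]) auto
qed

end
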